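(* Let $\mathcal{A}=\{M_1,\ldots,M_K\}$ be a set containing only a finite (fixed, not depending on $n$) number of different models, all including the null model $M_0$ as a special case, with $m_j=|M_j|>m_0=|M_0|$ for $j=1,\dots,K$. Let $m=\min_{1\le j\le K}|M_j|$ and $$\mathcal{K}_m=\{j\in\{1,\ldots,K\}:|M_j|=m\}=\{m(1),m(2),\ldots,m(\tilde m)\}.$$ Assume: (i) for each $j=1,\ldots,K$, the log-likelihood ratio $\mathcal{L}_j$ is bounded in probability as $n\to\infty$; (ii) $(\mathcal{L}_{m(1)},\ldots,\mathcal{L}_{m(\tilde m)})\xrightarrow{\mathcal{D}}(V_1,\ldots,V_{\tilde m})$ as $n\to\infty$, where $V_1,\ldots,V_{\tilde m}$ are jointly distributed random variables each having the $\chi^2_{m-m_0}$ distribution. Then, as $n\to\infty$, $$n^{(m-m_0)/2}(1-\pi_{\mathrm{BIC}})\xrightarrow{\mathcal{D}}\sum_{j=1}^{\tilde m}\exp\left(\tfrac12 V_j\right).$$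
   Context: The observed data vector has dimension (sample size) $n$. $M_0$ is a parametric null model and $M_1,\dots,M_K$ are alternative parametric models for the distribution of the data. $|M|$ denotes the dimension (number of parameters) of model $M$, and $m_j=|M_j|$, $j=0,\ldots,K$. $L_j$ denotes the likelihood function of model $M_j$ evaluated at its maximum likelihood estimate, $\mathcal{L}_j=2\log(L_j/L_0)$, and $$\pi_{\mathrm{BIC}}=\left\{1+\sum_{j=1}^{K}n^{-\frac12(m_j-m_0)}\exp\{\mathcal{L}_j/2\}\right\}^{-1}.$$ $\chi^2_k$ denotes the chi-squared distribution with $k$ degrees of freedom; $\xrightarrow{\mathcal{D}}$ denotes convergence in distribution. *)

theory Defs
  imports "HOL-Probability.Probability"
begin

section \<open>Parametric models and maximum likelihood\<close>

text \<open>Vectors of \<open>\<real>\<^sup>d\<close> with varying \<open>d\<close> (data vectors and parameter vectors) are extensional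
  functions on \<open>{..<d}\<close>.\<close>

definition data_space :: "nat \<Rightarrow> (nat \<Rightarrow> real) measure" where
  "data_space n = PiM {..<n} (\<lambda>_. borel)"

text \<open>\<open>npar M\<close> is the dimension \<open>|M|\<close>; \<open>lik M n \<theta> x\<close> is the density under \<open>\<theta>\<close> of the data vector at
  \<open>x \<in> \<real>\<^sup>n\<close>, i.e. the likelihood of \<open>\<theta>\<close> when \<open>x\<close> is observed.\<close>

record pmodel =
  npar :: nat
  params :: "(nat \<Rightarrow> real) set"
  lik :: "nat \<Rightarrow> (nat \<Rightarrow> real) \<Rightarrow> (nat \<Rightarrow> real) \<Rightarrow> real"

definition model_law :: "(nat \<Rightarrow> (nat \<Rightarrow> real) measure) \<Rightarrow> pmodel \<Rightarrow> nat \<Rightarrow> (nat \<Rightarrow> real)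
    \<Rightarrow> (nat \<Rightarrow> real) measure" where
  "model_law \<nu> M n \<theta> = density (\<nu> n) (\<lambda>x. ennreal (lik M n \<theta> x))"

text \<open>The densities are taken with respect to a reference measure \<open>\<nu> n\<close> on \<open>\<real>\<^sup>n\<close> (Lebesgue measure,
  counting measure on a lattice, \<open>\<dots>\<close>), which has to be the same for all models that are compared,
  for likelihood ratios to make sense.\<close>

definition parametric_model :: "(nat \<Rightarrow> (nat \<Rightarrow> real) measure) \<Rightarrow> pmodel \<Rightarrow> bool" where
  "parametric_model \<nu> M \<longleftrightarrow>
     params M \<subseteq> (\<Pi>\<^sub>E i\<in>{..<npar M}. UNIV) \<and>
     (\<forall>n\<ge>1. \<forall>\<theta>\<in>params M.
        lik M n \<theta> \<in> borel_measurable (\<nu> n) \<and>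
        (\<forall>x\<in>space (\<nu> n). 0 \<le> lik M n \<theta> x) \<and>
        prob_space (model_law \<nu> M n \<theta>))"

definition special_case :: "(nat \<Rightarrow> (nat \<Rightarrow> real) measure) \<Rightarrow> pmodel \<Rightarrow> pmodel \<Rightarrow> bool" where
  "special_case \<nu> M0 M \<longleftrightarrow>
     (\<forall>n\<ge>1. model_law \<nu> M0 n ` params M0 \<subseteq> model_law \<nu> M n ` params M)"

definition has_mle :: "pmodel \<Rightarrow> nat \<Rightarrow> (nat \<Rightarrow> real) \<Rightarrow> bool" where
  "has_mle M n x \<longleftrightarrow> (\<exists>\<theta>. is_arg_max (\<lambda>\<theta>. lik M n \<theta> x) (\<lambda>\<theta>. \<theta> \<in> params M) \<theta>)"

definition mle :: "pmodel \<Rightarrow> nat \<Rightarrow> (nat \<Rightarrow> real) \<Rightarrow> (nat \<Rightarrow> real)" where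
  "mle M n x = arg_max_on (\<lambda>\<theta>. lik M n \<theta> x) (params M)"

text \<open>If there are several maximum likelihood estimates, the following value does not depend on
  which of them \<open>arg_max_on\<close> picks.\<close>

definition max_lik :: "pmodel \<Rightarrow> nat \<Rightarrow> (nat \<Rightarrow> real) \<Rightarrow> real" where
  "max_lik M n x = lik M n (mle M n x) x"


section \<open>Log-likelihood ratios and the BIC weight of the null model\<close>

text \<open>The null model is \<open>M 0\<close>, the alternative models are \<open>M 1, \<dots>, M K\<close>. The convention
  \<open>ln 0 = 0 = a / 0\<close> makes \<open>llr\<close> zero at data for which one of the two maximised likelihoods vanishes.\<close>

definition llr :: "(nat \<Rightarrow> pmodel) \<Rightarrow> nat \<Rightarrow> nat \<Rightarrow> (nat \<Rightarrow> real) \<Rightarrow> real" where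
  "llr M j n x = 2 * ln (max_lik (M j) n x / max_lik (M 0) n x)"

definition pi_BIC :: "(nat \<Rightarrow> pmodel) \<Rightarrow> nat \<Rightarrow> nat \<Rightarrow> (nat \<Rightarrow> real) \<Rightarrow> real" where
  "pi_BIC M K n x =
     inverse (1 + (\<Sum>j = 1..K. real n powr (- (1/2) * (real (npar (M j)) - real (npar (M 0))))
                                * exp (llr M j n x / 2)))"

definition min_npar :: "(nat \<Rightarrow> pmodel) \<Rightarrow> nat \<Rightarrow> nat" where
  "min_npar M K = Min ((\<lambda>j. npar (M j)) ` {1..K})"

definition min_models :: "(nat \<Rightarrow> pmodel) \<Rightarrow> nat \<Rightarrow> nat set" where
  "min_models M K = {j \<in> {1..K}. npar (M j) = min_npar M K}"


section \<open>Probabilistic notions\<close>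

definition chi_square :: "nat \<Rightarrow> real measure" where
  "chi_square k =
     distr (PiM {..<k} (\<lambda>_. density lborel std_normal_density)) borel (\<lambda>z. \<Sum>i<k. (z i)\<^sup>2)"

definition bounded_in_probability :: "(nat \<Rightarrow> 'w measure) \<Rightarrow> (nat \<Rightarrow> 'w \<Rightarrow> real) \<Rightarrow> bool" where
  "bounded_in_probability \<Omega> Y \<longleftrightarrow>
     (\<forall>\<epsilon>>0. \<exists>C. \<forall>\<^sub>F n in sequentially. measure (\<Omega> n) {\<omega> \<in> space (\<Omega> n). \<bar>Y n \<omega>\<bar> > C} \<le> \<epsilon>)"

text \<open>The library's \<open>weak_conv_m\<close> is restricted to the real line; this is weak convergence of
  the laws of random vectors.\<close>

definition weak_conv_vec :: "(nat \<Rightarrow> 'a::euclidean_space measure) \<Rightarrow> 'a measure \<Rightarrow> bool" where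
  "weak_conv_vec \<mu> \<mu>' \<longleftrightarrow>
     (\<forall>f :: 'a \<Rightarrow> real. continuous_on UNIV f \<and> bounded (range f) \<longrightarrow>
        (\<lambda>n. integral\<^sup>L (\<mu> n) f) \<longlonglongrightarrow> integral\<^sup>L \<mu>' f)"

end

theory Submission
  imports Defs
begin

text \<open>With \<open>S\<close> the sum in the definition of \<open>pi_BIC\<close> we have \<open>1 - pi_BIC = S / (1 + S)\<close>. Multiplied
  by \<open>n powr ((m - m\<^sub>0) / 2)\<close>, the terms of \<open>S\<close> that belong to minimal models lose their power
  of \<open>n\<close>. As long as all log-likelihood ratios stay below a constant, which happens with probability
  close to one, the other terms and \<open>S\<close> itself are of order \<open>n powr (- 1/2)\<close>, since dimensions are
  integers. The scaled weight thus differs from the sum of \<open>exp (llr / 2)\<close> over the minimal models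
  by a quantity that tends to zero in probability, and the continuous mapping theorem and Slutsky's
  lemma apply.\<close>

section \<open>Weak convergence under index shifts and continuous maps\<close>

text \<open>The theorem assumes probability spaces and measurability for \<open>n \<ge> 1\<close>
  only, while the limit lemmas below quantify over all indices. Passing to \<open>Suc n\<close>
  bridges this gap; here the shift is undone for the conclusion, in the next lemma it is applied to
  the hypothesis.\<close>

lemma weak_conv_m_Suc:
  "weak_conv_m (\<lambda>n. \<mu> (Suc n)) L \<longleftrightarrow> weak_conv_m \<mu> L"
  unfolding weak_conv_m_def weak_conv_def
  using filterlim_sequentially_Suc[of "\<lambda>n. cdf (\<mu> n) x" for x] by simp

lemma weak_conv_vec_Suc:
  "weak_conv_vec (\<lambda>n. \<mu> (Suc n)) L \<longleftrightarrow> weak_conv_vec \<mu> L"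
  unfolding weak_conv_vec_def
  by (subst filterlim_sequentially_Suc[of "\<lambda>n. integral\<^sup>L (\<mu> n) f" for f]) (rule refl)

text \<open>Continuous mapping theorem: a bounded continuous test function composed with
  \<open>g\<close> is again bounded and continuous, so it may be inserted into
  \<open>conv\<close>.\<close>

lemma weak_conv_vec_continuous_map:
  fixes X :: "nat \<Rightarrow> 'w \<Rightarrow> 'a::euclidean_space" and g :: "'a \<Rightarrow> 'b::euclidean_space"
  assumes X: "\<And>n. X n \<in> borel_measurable (\<Omega> n)" and Y: "Y \<in> borel_measurable W"
    and g: "continuous_on UNIV g"
    and conv: "weak_conv_vec (\<lambda>n. distr (\<Omega> n) borel (X n)) (distr W borel Y)"
  shows "weak_conv_vec (\<lambda>n. distr (\<Omega> n) borel (\<lambda>\<omega>. g (X n \<omega>))) (distr W borel (\<lambda>v. g (Y v)))"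
  unfolding weak_conv_vec_def
proof (intro allI impI, elim conjE)
  fix f :: "'b \<Rightarrow> real"
  assume f: "continuous_on UNIV f" "bounded (range f)"
  have [measurable]: "f \<in> borel_measurable borel" "g \<in> borel_measurable borel"
    using f(1) g by (auto intro: borel_measurable_continuous_onI)
  note [measurable] = X Y
  have "continuous_on UNIV (\<lambda>x. f (g x))"
    using continuous_on_compose2[OF f(1) g] by simp
  moreover have "bounded (range (\<lambda>x. f (g x)))"
    by (rule bounded_subset[OF f(2)]) auto
  ultimately
  have "(\<lambda>n. integral\<^sup>L (distr (\<Omega> n) borel (X n)) (\<lambda>x. f (g x)))
      \<longlonglongrightarrow> integral\<^sup>L (distr W borel Y) (\<lambda>x. f (g x))"
    using conv unfolding weak_conv_vec_def by blast
  then show "(\<lambda>n. integral\<^sup>L (distr (\<Omega> n) borel (\<lambda>\<omega>. g (X n \<omega>))) f)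
      \<longlonglongrightarrow> integral\<^sup>L (distr W borel (\<lambda>v. g (Y v))) f"
    by (simp add: integral_distr)
qed

section \<open>Slutsky's lemma by continuous step functions\<close>

text \<open>The step is the affine function \<open>(b - x) / (b - a)\<close> clamped to the interval
  from 0 to 1, and clamping does not increase distances.\<close>

lemma cts_step_lipschitz:
  assumes "a < b"
  shows "\<bar>cts_step a b x - cts_step a b y\<bar> \<le> \<bar>x - y\<bar> / (b - a)"
proof -
  have clamp: "cts_step a b t = max 0 (min 1 ((b - t) / (b - a)))" for t
    using assms by (auto simp: cts_step_def max_def min_def divide_simps)
  have "\<bar>cts_step a b x - cts_step a b y\<bar> \<le> \<bar>(b - x) / (b - a) - (b - y) / (b - a)\<bar>"
    unfolding clamp by linarith
  also have "\<dots> = \<bar>x - y\<bar> / (b - a)"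
    using assms by (simp add: diff_divide_distrib[symmetric] abs_minus_commute)
  finally show ?thesis .
qed

lemma cts_step_nonneg: "0 \<le> cts_step a b x"
  and cts_step_le_1: "cts_step a b x \<le> 1"
  by (auto simp: cts_step_def divide_simps)

text \<open>The integrand is split along the event that \<open>Y\<close> and \<open>Z\<close> differ
  by more than \<open>\<delta>\<close>: off it the Lipschitz bound applies, on it two values between
  0 and 1 differ by at most 1.\<close>

lemma (in prob_space) integral_cts_step_diff_le:
  assumes [measurable]: "Y \<in> borel_measurable M" "Z \<in> borel_measurable M"
    and "a < b" "\<delta> \<ge> 0"
  shows "\<bar>(\<integral>\<omega>. cts_step a b (Z \<omega>) \<partial>M) - (\<integral>\<omega>. cts_step a b (Y \<omega>) \<partial>M)\<bar>
    \<le> \<delta> / (b - a) + prob {\<omega> \<in> space M. \<delta> < \<bar>Z \<omega> - Y \<omega>\<bar>}"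
proof -
  let ?B = "{\<omega> \<in> space M. \<delta> < \<bar>Z \<omega> - Y \<omega>\<bar>}"
  let ?d = "\<lambda>\<omega>. cts_step a b (Z \<omega>) - cts_step a b (Y \<omega>)"
  have [measurable]: "cts_step a b \<in> borel_measurable borel"
    by (auto simp: cts_step_def[abs_def])
  have int: "integrable M (\<lambda>\<omega>. cts_step a b (U \<omega>))" if [measurable]: "U \<in> borel_measurable M" for U
    by (rule integrable_const_bound[where B = 1]) (auto simp: cts_step_nonneg cts_step_le_1)
  have "\<bar>expectation ?d\<bar> \<le> expectation (\<lambda>\<omega>. \<bar>?d \<omega>\<bar>)"
    by (rule integral_abs_bound)
  also have "\<dots> \<le> expectation (\<lambda>\<omega>. \<delta> / (b - a) + indicator ?B \<omega>)"
  proof (rule integral_mono)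
    show "integrable M (\<lambda>\<omega>. \<bar>?d \<omega>\<bar>)"
      by (intro integrable_abs Bochner_Integration.integrable_diff int) auto
    show "integrable M (\<lambda>\<omega>. \<delta> / (b - a) + indicator ?B \<omega>)"
      by (intro Bochner_Integration.integrable_add) (auto simp: emeasure_eq_measure)
    fix \<omega> assume "\<omega> \<in> space M"
    show "\<bar>?d \<omega>\<bar> \<le> \<delta> / (b - a) + indicator ?B \<omega>"
    proof (cases "\<omega> \<in> ?B")
      case True
      moreover have "\<bar>?d \<omega>\<bar> \<le> 1"
        using cts_step_nonneg cts_step_le_1 by (smt (verit))
      moreover have "0 \<le> \<delta> / (b - a)"
        using assms by simp
      ultimately show ?thesis
        by simp
    next
      case False
      have "\<bar>?d \<omega>\<bar> \<le> \<bar>Z \<omega> - Y \<omega>\<bar> / (b - a)"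
        using \<open>a < b\<close> by (rule cts_step_lipschitz)
      also have "\<dots> \<le> \<delta> / (b - a)"
        using False \<open>\<omega> \<in> space M\<close> \<open>a < b\<close> by (intro divide_right_mono) auto
      finally show ?thesis
        using False by simp
    qed
  qed
  also have "\<dots> = \<delta> / (b - a) + prob ?B"
    by (subst Bochner_Integration.integral_add)
       (auto simp: emeasure_eq_measure prob_space Collect_conj_eq[symmetric] Int_def conj_commute)
  finally show ?thesis
    by (simp add: int)
qed

text \<open>Slutsky's lemma, which also passes from test functions to distribution functions: on the
  real line it suffices to test with \<open>cts_step a b\<close>, and replacing \<open>Y\<close> by
  \<open>Z\<close> changes these integrals by a null sequence.\<close>

lemma weak_conv_m_slutsky:
  fixes Y Z :: "nat \<Rightarrow> 'w \<Rightarrow> real"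
  assumes prob: "\<And>n. prob_space (\<Omega> n)"
    and Y: "\<And>n. Y n \<in> borel_measurable (\<Omega> n)" and Z: "\<And>n. Z n \<in> borel_measurable (\<Omega> n)"
    and close: "\<And>\<delta>. \<delta> > 0 \<Longrightarrow>
      (\<lambda>n. measure (\<Omega> n) {\<omega> \<in> space (\<Omega> n). \<delta> < \<bar>Z n \<omega> - Y n \<omega>\<bar>}) \<longlonglongrightarrow> 0"
    and L: "real_distribution L"
    and conv: "weak_conv_vec (\<lambda>n. distr (\<Omega> n) borel (Y n)) L"
  shows "weak_conv_m (\<lambda>n. distr (\<Omega> n) borel (Z n)) L"
proof (rule integral_cts_step_conv_imp_weak_conv)
  show "real_distribution (distr (\<Omega> n) borel (Z n))" for n
    using prob_space.real_distribution_distr[OF prob Z] .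
  show "real_distribution L" by fact
  fix a b :: real assume "a < b"
  let ?f = "cts_step a b"
  have cont: "continuous_on UNIV ?f"
    using cts_step_uniformly_continuous[OF \<open>a < b\<close>] by (rule uniformly_continuous_imp_continuous)
  have [measurable]: "?f \<in> borel_measurable borel"
    using cont by (rule borel_measurable_continuous_onI)
  note [measurable] = Y Z
  let ?y = "\<lambda>n. \<integral>\<omega>. ?f (Y n \<omega>) \<partial>\<Omega> n" and ?z = "\<lambda>n. \<integral>\<omega>. ?f (Z n \<omega>) \<partial>\<Omega> n"
  have "bounded (range ?f)"
    by (rule boundedI[where B = 1]) (auto simp: cts_step_nonneg cts_step_le_1)
  with cont have "(\<lambda>n. integral\<^sup>L (distr (\<Omega> n) borel (Y n)) ?f) \<longlonglongrightarrow> integral\<^sup>L L ?f"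
    using conv unfolding weak_conv_vec_def by blast
  then have y: "?y \<longlonglongrightarrow> integral\<^sup>L L ?f"
    by (simp add: integral_distr)
  have "(\<lambda>n. ?z n - ?y n) \<longlonglongrightarrow> 0"
  proof (rule tendstoI)
    fix \<epsilon> :: real assume "\<epsilon> > 0"
    \<comment> \<open>Chosen so that the Lipschitz term \<open>\<delta> / (b - a)\<close> takes one
      half of \<open>\<epsilon>\<close>; the probability of a larger deviation takes the other
      half.\<close>
    define \<delta> where "\<delta> = \<epsilon> * (b - a) / 2"
    have "\<delta> > 0" "\<delta> / (b - a) = \<epsilon> / 2"
      using \<open>\<epsilon> > 0\<close> \<open>a < b\<close> by (simp_all add: \<delta>_def divide_simps)
    have "\<forall>\<^sub>F n in sequentially.
        measure (\<Omega> n) {\<omega> \<in> space (\<Omega> n). \<delta> < \<bar>Z n \<omega> - Y n \<omega>\<bar>} < \<epsilon> / 2"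
      using close[OF \<open>\<delta> > 0\<close>] \<open>\<epsilon> > 0\<close> by (intro order_tendstoD) auto
    then show "\<forall>\<^sub>F n in sequentially. dist (?z n - ?y n) 0 < \<epsilon>"
    proof eventually_elim
      case (elim n)
      with prob_space.integral_cts_step_diff_le[OF prob Y Z \<open>a < b\<close>, of \<delta> n] \<open>\<delta> > 0\<close>
        \<open>\<delta> / (b - a) = \<epsilon> / 2\<close>
      show ?case by (simp add: dist_real_def)
    qed
  qed
  from tendsto_add[OF this y] show "(\<lambda>n. integral\<^sup>L (distr (\<Omega> n) borel (Z n)) ?f) \<longlonglongrightarrow> integral\<^sup>L L ?f"
    by (simp add: integral_distr)
qed

section \<open>Simultaneous bounds and the deterministic estimate\<close>

text \<open>A union bound, with \<open>\<epsilon>\<close> shared among the members of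
  \<open>J\<close>, yields one constant for all sequences at once.\<close>

lemma bounded_in_probability_finite:
  assumes prob: "\<And>n. n \<ge> 1 \<Longrightarrow> prob_space (\<Omega> n)"
    and meas: "\<And>n j. n \<ge> 1 \<Longrightarrow> j \<in> J \<Longrightarrow> Y j n \<in> borel_measurable (\<Omega> n)"
    and "finite J" and bdd: "\<And>j. j \<in> J \<Longrightarrow> bounded_in_probability \<Omega> (Y j)"
    and "\<epsilon> > 0"
  obtains C where "\<forall>\<^sub>F n in sequentially.
    measure (\<Omega> n) {\<omega> \<in> space (\<Omega> n). \<exists>j\<in>J. C < \<bar>Y j n \<omega>\<bar>} \<le> \<epsilon>"
proof -
  \<comment> \<open>Adding 1 keeps the denominator positive for empty \<open>J\<close>.\<close>
  define \<eta> where "\<eta> = \<epsilon> / (1 + real (card J))"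
  have "\<eta> > 0" using \<open>\<epsilon> > 0\<close> by (simp add: \<eta>_def add_pos_nonneg)
  then have "\<forall>j\<in>J. \<exists>C. \<forall>\<^sub>F n in sequentially.
      measure (\<Omega> n) {\<omega> \<in> space (\<Omega> n). C < \<bar>Y j n \<omega>\<bar>} \<le> \<eta>"
    using bdd unfolding bounded_in_probability_def by blast
  from bchoice[OF this] obtain c where c: "\<And>j. j \<in> J \<Longrightarrow> \<forall>\<^sub>F n in sequentially.
      measure (\<Omega> n) {\<omega> \<in> space (\<Omega> n). c j < \<bar>Y j n \<omega>\<bar>} \<le> \<eta>"
    by blast
  \<comment> \<open>The sum of absolute values dominates every \<open>c j\<close> and, unlike a
    maximum, also makes sense for empty \<open>J\<close>.\<close>
  define C where "C = (\<Sum>j\<in>J. \<bar>c j\<bar>)"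
  have C: "c j \<le> C" if "j \<in> J" for j
    using member_le_sum[of j J "\<lambda>j. \<bar>c j\<bar>"] that \<open>finite J\<close> by (auto simp: C_def)
  have "\<forall>\<^sub>F n in sequentially. n \<ge> 1 \<and>
      (\<forall>j\<in>J. measure (\<Omega> n) {\<omega> \<in> space (\<Omega> n). c j < \<bar>Y j n \<omega>\<bar>} \<le> \<eta>)"
    using c \<open>finite J\<close> by (auto intro!: eventually_conj eventually_ball_finite eventually_ge_at_top)
  then have "\<forall>\<^sub>F n in sequentially.
    measure (\<Omega> n) {\<omega> \<in> space (\<Omega> n). \<exists>j\<in>J. C < \<bar>Y j n \<omega>\<bar>} \<le> \<epsilon>"
  proof eventually_elim
    case (elim n)
    interpret prob_space "\<Omega> n" using prob elim by blast
    let ?B = "\<lambda>j. {\<omega> \<in> space (\<Omega> n). c j < \<bar>Y j n \<omega>\<bar>}"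
    have [measurable]: "Y j n \<in> borel_measurable (\<Omega> n)" if "j \<in> J" for j
      using meas elim that by blast
    have B: "?B j \<in> events" if "j \<in> J" for j
      using that by measurable
    have "prob {\<omega> \<in> space (\<Omega> n). \<exists>j\<in>J. C < \<bar>Y j n \<omega>\<bar>} \<le> prob (\<Union>j\<in>J. ?B j)"
      using C B \<open>finite J\<close> by (intro finite_measure_mono) fastforce+
    also have "\<dots> \<le> (\<Sum>j\<in>J. prob (?B j))"
      using B \<open>finite J\<close> by (intro finite_measure_subadditive_finite) auto
    also have "\<dots> \<le> real (card J) * \<eta>"
      using elim by (intro sum_bounded_above) auto
    also have "\<dots> \<le> \<epsilon>"
      using \<open>\<epsilon> > 0\<close> by (simp add: \<eta>_def field_simps)
    finally show ?case .
  qed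
  then show ?thesis by (rule that)
qed

text \<open>The pointwise core of the proof, with \<open>I\<close> standing for the minimal models.
  Let \<open>S\<close> be the full sum, \<open>T\<close> the sum over \<open>I\<close>, and
  \<open>R\<close> the scaled rest. Then \<open>N powr d * S = R + T\<close>, so the difference to
  be bounded equals \<open>(R - S * T) / (1 + S)\<close>. Here \<open>R\<close> and \<open>S\<close>
  are at most \<open>N powr (- 1/2) * B\<close>, and \<open>T\<close> is at most
  \<open>B\<close>.\<close>

lemma scaled_weight_approx:
  fixes N C d :: real and a l :: "'j \<Rightarrow> real"
  assumes N: "N \<ge> 1" and J: "finite J" "I \<subseteq> J" and d: "d \<ge> 1/2"
    and a_I: "\<And>j. j \<in> I \<Longrightarrow> a j = d" and a_J: "\<And>j. j \<in> J - I \<Longrightarrow> a j \<ge> d + 1/2"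
    and l: "\<And>j. j \<in> J \<Longrightarrow> l j \<le> C"
  defines "B \<equiv> real (card J) * exp (C / 2)"
  shows "\<bar>N powr d * (1 - inverse (1 + (\<Sum>j\<in>J. N powr (- a j) * exp (l j / 2))))
      - (\<Sum>j\<in>I. exp (l j / 2))\<bar> \<le> N powr (- (1/2)) * (B + B\<^sup>2)"
proof -
  define S where "S = (\<Sum>j\<in>J. N powr (- a j) * exp (l j / 2))"
  define T where "T = (\<Sum>j\<in>I. exp (l j / 2))"
  define R where "R = (\<Sum>j\<in>J - I. N powr (d - a j) * exp (l j / 2))"
  let ?h = "N powr (- (1/2))"
  have exp_le: "exp (l j / 2) \<le> exp (C / 2)" if "j \<in> J" for j
    using l[OF that] by simp
  have "B \<ge> 0" by (simp add: B_def)
  have S: "0 \<le> S" "S \<le> ?h * B"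
  proof -
    have "N powr (- a j) * exp (l j / 2) \<le> ?h * exp (C / 2)" if "j \<in> J" for j
    proof (intro mult_mono powr_mono exp_le that N)
      \<comment> \<open>On \<open>I\<close> the exponent is \<open>d \<ge> 1/2\<close>; elsewhere it
        is larger still.\<close>
      show "- a j \<le> - (1/2)" using a_I[of j] a_J[of j] that d by (cases "j \<in> I") auto
    qed auto
    from sum_bounded_above[of J, OF this] show "S \<le> ?h * B"
      by (simp add: S_def B_def mult_ac)
  qed (simp add: S_def sum_nonneg)
  have R: "0 \<le> R" "R \<le> ?h * B"
  proof -
    have "R \<le> (\<Sum>j\<in>J - I. ?h * exp (C / 2))"
      unfolding R_def
    proof (intro sum_mono mult_mono powr_mono exp_le N)
      show "d - a j \<le> - (1/2)" if "j \<in> J - I" for j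
        using a_J[OF that] by simp
    qed auto
    also have "\<dots> \<le> (\<Sum>j\<in>J. ?h * exp (C / 2))"
      using J by (intro sum_mono2) auto
    finally show "R \<le> ?h * B"
      by (simp add: B_def mult_ac)
  qed (simp add: R_def sum_nonneg)
  have T: "0 \<le> T" "T \<le> B"
  proof -
    have "T \<le> (\<Sum>j\<in>I. exp (C / 2))"
      unfolding T_def using J exp_le by (intro sum_mono) auto
    also have "\<dots> \<le> (\<Sum>j\<in>J. exp (C / 2))"
      using J by (intro sum_mono2) auto
    finally show "T \<le> B" by (simp add: B_def)
  qed (simp add: T_def sum_nonneg)
  have "N powr d * S = (\<Sum>j\<in>J. N powr (d - a j) * exp (l j / 2))"
    using N by (simp add: S_def sum_distrib_left powr_diff powr_minus field_simps)
  also have "\<dots> = R + (\<Sum>j\<in>I. N powr (d - a j) * exp (l j / 2))"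
    unfolding R_def using J by (intro sum.subset_diff) auto
  \<comment> \<open>On \<open>I\<close> the scaling cancels the power of \<open>N\<close> exactly,
    leaving \<open>N powr 0 = 1\<close>.\<close>
  also have "(\<Sum>j\<in>I. N powr (d - a j) * exp (l j / 2)) = T"
    using N by (simp add: T_def a_I)
  finally have NS: "N powr d * S = R + T" .
  have "N powr d * (1 - inverse (1 + S)) - T = (N powr d * S) / (1 + S) - T"
    using S(1) by (simp add: field_simps)
  also have "\<dots> = (R - S * T) / (1 + S)"
    using S(1) unfolding NS by (simp add: field_simps)
  finally have "\<bar>N powr d * (1 - inverse (1 + S)) - T\<bar> = \<bar>R - S * T\<bar> / (1 + S)"
    using S(1) by simp
  also have "\<dots> \<le> \<bar>R - S * T\<bar> / 1"
    using S(1) by (intro divide_left_mono) auto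
  also have "\<dots> \<le> R + S * T"
    using R(1) S(1) T(1) by (simp add: abs_le_iff)
  also have "\<dots> \<le> ?h * B + (?h * B) * B"
    using R S T \<open>B \<ge> 0\<close> by (intro add_mono mult_mono) auto
  finally show ?thesis
    by (simp add: S_def T_def power2_eq_square algebra_simps)
qed

section \<open>Convergence of the scaled weight\<close>

lemma borel_measurable_vec_lambda:
  fixes f :: "'i::finite \<Rightarrow> 'w \<Rightarrow> real"
  assumes [measurable]: "\<And>i. f i \<in> borel_measurable M"
  shows "(\<lambda>\<omega>. \<chi> i. f i \<omega>) \<in> borel_measurable M"
  by (subst borel_measurable_euclidean_space) (auto simp: Basis_vec_def inner_axis)

theorem theorem1:
  fixes M :: "nat \<Rightarrow> pmodel" and K :: nat
    and \<nu> :: "nat \<Rightarrow> (nat \<Rightarrow> real) measure"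
    and \<Omega> :: "nat \<Rightarrow> 'w measure" and X :: "nat \<Rightarrow> 'w \<Rightarrow> (nat \<Rightarrow> real)"
    and idx :: "'r::finite \<Rightarrow> nat"
    and W :: "'v measure" and V :: "'r \<Rightarrow> 'v \<Rightarrow> real"
  assumes K: "K \<ge> 1"
    and reference: "\<And>n. n \<ge> 1 \<Longrightarrow> sigma_finite_measure (\<nu> n) \<and> sets (\<nu> n) = sets (data_space n)"
    and models: "\<And>j. j \<le> K \<Longrightarrow> parametric_model \<nu> (M j)"
    and different: "inj_on M {1..K}"
    and nested: "\<And>j. j \<in> {1..K} \<Longrightarrow> special_case \<nu> (M 0) (M j)"
    and larger: "\<And>j. j \<in> {1..K} \<Longrightarrow> npar (M j) > npar (M 0)"
    and prob: "\<And>n. n \<ge> 1 \<Longrightarrow> prob_space (\<Omega> n)"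
    and data: "\<And>n. n \<ge> 1 \<Longrightarrow> X n \<in> measurable (\<Omega> n) (data_space n)"
    and mle_exists: "\<And>n j. n \<ge> 1 \<Longrightarrow> j \<le> K \<Longrightarrow> AE \<omega> in \<Omega> n. has_mle (M j) n (X n \<omega>)"
    and max_lik_measurable: "\<And>n j. n \<ge> 1 \<Longrightarrow> j \<le> K \<Longrightarrow>
          (\<lambda>\<omega>. max_lik (M j) n (X n \<omega>)) \<in> borel_measurable (\<Omega> n)"
    and enumeration: "bij_betw idx UNIV (min_models M K)"
    and bounded_llr: "\<And>j. j \<in> {1..K} \<Longrightarrow>
          bounded_in_probability \<Omega> (\<lambda>n \<omega>. llr M j n (X n \<omega>))"
    and prob_V: "prob_space W"
    and V_measurable: "\<And>i. V i \<in> borel_measurable W"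
    and V_chi_square: "\<And>i. distr W borel (V i) = chi_square (min_npar M K - npar (M 0))"
    and joint_conv: "weak_conv_vec
          (\<lambda>n. distr (\<Omega> n) borel (\<lambda>\<omega>. (\<chi> i. llr M (idx i) n (X n \<omega>)) :: real ^ 'r))
          (distr W borel (\<lambda>v. \<chi> i. V i v))"
  shows "weak_conv_m
          (\<lambda>n. distr (\<Omega> n) borel (\<lambda>\<omega>.
             real n powr ((real (min_npar M K) - real (npar (M 0))) / 2) * (1 - pi_BIC M K n (X n \<omega>))))
          (distr W borel (\<lambda>v. \<Sum>i\<in>UNIV. exp (1/2 * V i v)))"
proof -
  define d where "d = (real (min_npar M K) - real (npar (M 0))) / 2"
  define l where "l = (\<lambda>j n \<omega>. llr M j n (X n \<omega>))"
  define Y where "Y = (\<lambda>n \<omega>. \<Sum>i\<in>UNIV. exp (l (idx i) n \<omega> / 2))"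
  define Z where "Z = (\<lambda>n \<omega>. real n powr d * (1 - pi_BIC M K n (X n \<omega>)))"
  let ?J = "{1..K}" and ?I = "min_models M K"
  let ?g = "\<lambda>x :: real ^ 'r. \<Sum>i\<in>UNIV. exp (x $ i / 2)"
  have I: "?I \<subseteq> ?J"
    by (auto simp: min_models_def)
  have idx: "idx i \<in> ?J" for i
    using bij_betwE[OF enumeration] I by blast
  \<comment> \<open>Since \<open>K \<ge> 1\<close>, the minimum is attained by some alternative, to
    which the strict inequality \<open>larger\<close> applies; for integer dimensions this gives
    \<open>d \<ge> 1/2\<close>.\<close>
  have "min_npar M K \<in> (\<lambda>j. npar (M j)) ` ?J"
    unfolding min_npar_def using K by (intro Min_in) auto
  then have d: "d \<ge> 1/2"
    using larger by (fastforce simp: d_def)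
  have min_le: "min_npar M K \<le> npar (M j)" if "j \<in> ?J" for j
    using that by (auto simp: min_npar_def)
  have l: "l j n \<in> borel_measurable (\<Omega> n)" if "n \<ge> 1" "j \<in> ?J" for n j
  proof -
    have [measurable]: "(\<lambda>\<omega>. max_lik (M j) n (X n \<omega>)) \<in> borel_measurable (\<Omega> n)"
      "(\<lambda>\<omega>. max_lik (M 0) n (X n \<omega>)) \<in> borel_measurable (\<Omega> n)"
      using max_lik_measurable that by auto
    show ?thesis by (simp add: l_def llr_def)
  qed
  have pi_BIC_eq: "pi_BIC M K n (X n \<omega>) = inverse (1 + (\<Sum>j\<in>?J.
      real n powr (- ((real (npar (M j)) - real (npar (M 0))) / 2)) * exp (l j n \<omega> / 2)))" for n \<omega>
    by (simp add: pi_BIC_def l_def)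
  have Y: "Y n \<in> borel_measurable (\<Omega> n)" and Z: "Z n \<in> borel_measurable (\<Omega> n)"
    if "n \<ge> 1" for n
  proof -
    have [measurable]: "l j n \<in> borel_measurable (\<Omega> n)" if "j \<in> ?J" for j
      using l \<open>n \<ge> 1\<close> that by blast
    show "Y n \<in> borel_measurable (\<Omega> n)"
      unfolding Y_def using idx by measurable
    show "Z n \<in> borel_measurable (\<Omega> n)"
      unfolding Z_def pi_BIC_eq by measurable
  qed
  have approx: "\<bar>Z n \<omega> - Y n \<omega>\<bar> \<le> real n powr (- (1/2)) *
      (real K * exp (C / 2) + (real K * exp (C / 2))\<^sup>2)"
    if "n \<ge> 1" and C: "\<And>j. j \<in> ?J \<Longrightarrow> l j n \<omega> \<le> C" for n \<omega> C
  proof -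
    \<comment> \<open>The enumeration translates between the coordinates of the limit vector and the
      minimal models.\<close>
    have Y_eq: "Y n \<omega> = (\<Sum>j\<in>?I. exp (l j n \<omega> / 2))"
      unfolding Y_def using sum.reindex_bij_betw[OF enumeration] .
    have a: "(real (npar (M j)) - real (npar (M 0))) / 2 \<ge> d + 1/2" if "j \<in> ?J - ?I" for j
    proof -
      \<comment> \<open>A non-minimal dimension exceeds the minimum by at least one; halving gives
        the gap of 1/2 between the exponents.\<close>
      have "npar (M j) \<ge> min_npar M K + 1"
        using min_le[of j] that by (auto simp: min_models_def)
      then show ?thesis by (simp add: d_def field_simps)
    qed
    show ?thesis
      using scaled_weight_approx[of "real n" ?J ?I d
          "\<lambda>j. (real (npar (M j)) - real (npar (M 0))) / 2" "\<lambda>j. l j n \<omega>" C]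
        that I d a
      by (simp add: Z_def Y_eq pi_BIC_eq) (auto simp: min_models_def d_def)
  qed
  have close: "(\<lambda>n. measure (\<Omega> n) {\<omega> \<in> space (\<Omega> n). \<delta> < \<bar>Z n \<omega> - Y n \<omega>\<bar>}) \<longlonglongrightarrow> 0"
    if "\<delta> > 0" for \<delta>
  proof (rule tendstoI)
    fix \<epsilon> :: real assume "\<epsilon> > 0"
    then have "\<epsilon> / 2 > 0" by simp
    obtain C where C: "\<forall>\<^sub>F n in sequentially.
        measure (\<Omega> n) {\<omega> \<in> space (\<Omega> n). \<exists>j\<in>?J. C < \<bar>l j n \<omega>\<bar>} \<le> \<epsilon> / 2"
      by (rule bounded_in_probability_finite[where \<Omega> = \<Omega> and J = ?J and Y = l, OF prob l _ _ \<open>\<epsilon> / 2 > 0\<close>])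
         (use bounded_llr in \<open>auto simp: l_def\<close>)
    let ?c = "real K * exp (C / 2) + (real K * exp (C / 2))\<^sup>2"
    \<comment> \<open>\<open>C\<close> is fixed before \<open>n\<close> grows, so the error bound of
      \<open>approx\<close> is a constant times a null sequence and eventually drops below
      \<open>\<delta>\<close>.\<close>
    have "(\<lambda>n. real n powr (- (1/2)) * ?c) \<longlonglongrightarrow> 0 * ?c"
      by (intro tendsto_mult tendsto_const tendsto_neg_powr filterlim_real_sequentially) simp
    then have "\<forall>\<^sub>F n in sequentially. real n powr (- (1/2)) * ?c < \<delta>"
      using \<open>\<delta> > 0\<close> by (intro order_tendstoD) auto
    with C eventually_ge_at_top[of 1]
    show "\<forall>\<^sub>F n in sequentially.
        dist (measure (\<Omega> n) {\<omega> \<in> space (\<Omega> n). \<delta> < \<bar>Z n \<omega> - Y n \<omega>\<bar>}) 0 < \<epsilon>"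
    proof eventually_elim
      case (elim n)
      interpret prob_space "\<Omega> n" using prob elim by blast
      have [measurable]: "l j n \<in> borel_measurable (\<Omega> n)" if "j \<in> ?J" for j
        using l elim that by blast
      \<comment> \<open>Contrapositive of \<open>approx\<close>: if every ratio is at most
        \<open>C\<close> in absolute value, the error stays below \<open>\<delta>\<close>.\<close>
      have "\<exists>j\<in>?J. C < \<bar>l j n \<omega>\<bar>" if "\<delta> < \<bar>Z n \<omega> - Y n \<omega>\<bar>" for \<omega>
        using approx[of n \<omega> C] elim that by force
      then have "prob {\<omega> \<in> space (\<Omega> n). \<delta> < \<bar>Z n \<omega> - Y n \<omega>\<bar>}
          \<le> prob {\<omega> \<in> space (\<Omega> n). \<exists>j\<in>?J. C < \<bar>l j n \<omega>\<bar>}"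
        by (intro finite_measure_mono) auto
      with elim \<open>\<epsilon> > 0\<close> show ?case
        by simp
    qed
  qed
  have g: "continuous_on UNIV ?g"
    by (auto intro!: continuous_intros)
  have V: "(\<lambda>v. \<chi> i. V i v) \<in> borel_measurable W"
    using V_measurable by (rule borel_measurable_vec_lambda)
  \<comment> \<open>Continuous mapping with \<open>?g\<close>, applied to the shifted form of
    \<open>joint_conv\<close>.\<close>
  have "weak_conv_vec (\<lambda>n. distr (\<Omega> (Suc n)) borel (Y (Suc n)))
      (distr W borel (\<lambda>v. \<Sum>i\<in>UNIV. exp (1/2 * V i v)))"
    using weak_conv_vec_continuous_map[OF borel_measurable_vec_lambda V g,
        of "\<lambda>n i. l (idx i) (Suc n)" "\<lambda>n. \<Omega> (Suc n)"]
      l idx weak_conv_vec_Suc[THEN iffD2, OF joint_conv]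
    by (simp add: l_def Y_def)
  moreover have "real_distribution (distr W borel (\<lambda>v. \<Sum>i\<in>UNIV. exp (1/2 * V i v)))"
    using V_measurable by (intro prob_space.real_distribution_distr[OF prob_V]) simp
  \<comment> \<open>\<open>Z\<close> inherits the limit of \<open>Y\<close> by Slutsky's lemma;
    \<open>LIMSEQ_Suc\<close> shifts \<open>close\<close> to match the shifted sequences.\<close>
  ultimately have "weak_conv_m (\<lambda>n. distr (\<Omega> (Suc n)) borel (Z (Suc n)))
      (distr W borel (\<lambda>v. \<Sum>i\<in>UNIV. exp (1/2 * V i v)))"
    using prob Y Z close by (intro weak_conv_m_slutsky) (auto intro: LIMSEQ_Suc)
  then have "weak_conv_m (\<lambda>n. distr (\<Omega> n) borel (Z n))
      (distr W borel (\<lambda>v. \<Sum>i\<in>UNIV. exp (1/2 * V i v)))"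
    by (simp only: weak_conv_m_Suc[of "\<lambda>n. distr (\<Omega> n) borel (Z n)"])
  then show ?thesis
    by (simp only: Z_def d_def)
qed

end
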